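(* Let $p>1$, $\frac1p+\frac1q=1$, and $1\le\alpha\le 1+1/p$. Then for every complex sequence $\mathbf a=(a_n)_{n\ge1}\in l^p$, $$\sum_{n=1}^{\infty}\left|\frac{1}{n^{\alpha}}\sum_{i=1}^n\alpha\Big(i-\frac12\Big)^{\frac1p\left(\alpha-\frac1p\right)}\Big(\int_{i-1}^i x^{\alpha-1-1/p}\,dx\Big)^{1/q}a_i\right|^p\ \le\ \Big(\frac{\alpha p}{\alpha p-1}\Big)^p\sum_{n=1}^{\infty}|a_n|^p .$$
   Context: $l^p$ is the space of complex sequences with $\sum_n|a_n|^p<\infty$. *)

theory Defs
  imports "HOL-Analysis.Analysis"
begin

text \<open>Sequences \<open>(a\<^sub>n)\<close> are indexed by \<open>n \<ge> 1\<close>; the value \<open>a 0\<close> is irrelevant.\<close>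

definition lp_space :: "real \<Rightarrow> (nat \<Rightarrow> complex) set" where
  "lp_space p = {a. (\<lambda>n. norm (a n) powr p) summable_on {1..}}"

end

theory Submission
  imports Defs
begin

text \<open>
  Put \<open>\<gamma> = \<alpha> - 1/p > 0\<close>, so that the constant is \<open>\<alpha>/\<gamma>\<close>. The integrals over \<open>[i-1, i]\<close> add up to
  \<open>n powr \<gamma> / \<gamma>\<close>, so Hoelder's inequality bounds the \<open>p\<close>-th power of the \<open>n\<close>-th term by a multiple of
  \<open>n powr (- 1 - \<gamma>)\<close> times the sum of \<open>(i - 1/2) powr \<gamma> * \<bar>a\<^sub>i\<bar> powr p\<close> over \<open>i \<le> n\<close>. After exchanging
  the summations, the convexity of \<open>x powr (- 1 - \<gamma>)\<close> (midpoint rule) compares the sum over \<open>n \<ge> i\<close>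
  with the integral from \<open>i - 1/2\<close>, which cancels the weight exactly.
\<close>

text \<open>Dividing \<open>f\<close> and \<open>g\<close> by their norms reduces the claim to
  Young's inequality for each \<open>i\<close>: summed over \<open>I\<close>, its right-hand sides
  give 1 / p + 1 / q = 1. Vanishing norms, which cannot be divided by, are split off first.\<close>

lemma Holder_inequality_sum:
  fixes f g :: "'a \<Rightarrow> real"
  assumes "p > 1" "q > 1" and pq: "1 / p + 1 / q = 1" and fin: "finite I"
    and f: "\<And>i. i \<in> I \<Longrightarrow> 0 \<le> f i" and g: "\<And>i. i \<in> I \<Longrightarrow> 0 \<le> g i"
  shows "(\<Sum>i\<in>I. f i * g i) \<le>
    (\<Sum>i\<in>I. f i powr p) powr (1 / p) * (\<Sum>i\<in>I. g i powr q) powr (1 / q)"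
proof (cases "(\<Sum>i\<in>I. f i powr p) = 0 \<or> (\<Sum>i\<in>I. g i powr q) = 0")
  case True
  then have "f i * g i = 0" if "i \<in> I" for i
    using that fin by (auto simp: sum_nonneg_eq_0_iff)
  then have "(\<Sum>i\<in>I. f i * g i) = 0"
    by (rule sum.neutral[OF ballI])
  then show ?thesis
    by simp
next
  case False
  define A where "A = (\<Sum>i\<in>I. f i powr p)"
  define B where "B = (\<Sum>i\<in>I. g i powr q)"
  define C where "C = A powr (1 / p) * B powr (1 / q)"
  have AB: "A > 0" "B > 0"
    using False by (auto simp: A_def B_def less_le sum_nonneg)
  have "f i * g i / C \<le> f i powr p / (p * A) + g i powr q / (q * B)" if "i \<in> I" for i
  proof -
    have "(f i / A powr (1 / p)) * (g i / B powr (1 / q))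
        \<le> (f i / A powr (1 / p)) powr p / p + (g i / B powr (1 / q)) powr q / q"
      using assms that by (intro Youngs_inequality) auto
    also have "\<dots> = f i powr p / (p * A) + g i powr q / (q * B)"
      using AB assms(1,2) f[OF that] g[OF that]
      by (simp add: powr_divide powr_powr mult.commute)
    finally show ?thesis
      by (simp add: C_def)
  qed
  then have "(\<Sum>i\<in>I. f i * g i / C) \<le> (\<Sum>i\<in>I. f i powr p / (p * A) + g i powr q / (q * B))"
    by (rule sum_mono)
  also have "\<dots> = A / (p * A) + B / (q * B)"
    by (simp add: sum.distrib A_def B_def sum_divide_distrib)
  also have "\<dots> = 1"
    using AB pq by simp
  finally have "(\<Sum>i\<in>I. f i * g i) / C \<le> 1"
    by (simp add: sum_divide_distrib)
  moreover have "C > 0"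
    using AB by (simp add: C_def)
  ultimately show ?thesis
    by (simp add: C_def A_def B_def)
qed

text \<open>Midpoint convexity of the negative power, from the inequality u^2 + v^2 >= 2 u v with
  u^2 and v^2 the two terms on the right. Since (x - h) (x + h) <= x^2 and the exponent is
  nonpositive, u v is at least \<open>x powr (- s)\<close>.\<close>

lemma powr_neg_add_ge:
  fixes h s x :: real
  assumes "s \<ge> 0" "0 \<le> h" "h < x"
  shows "2 * x powr (- s) \<le> (x - h) powr (- s) + (x + h) powr (- s)"
proof -
  define u where "u = (x - h) powr (- s / 2)"
  define v where "v = (x + h) powr (- s / 2)"
  have "(x - h) * (x + h) > 0"
    using assms by simp
  then have "(x * x) powr (- s / 2) \<le> ((x - h) * (x + h)) powr (- s / 2)"
    using assms by (intro powr_mono2') (auto simp: algebra_simps)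
  then have "x powr (- s) \<le> u * v"
    using assms by (simp add: powr_mult u_def v_def flip: powr_add)
  moreover have "u\<^sup>2 = (x - h) powr (- s)" "v\<^sup>2 = (x + h) powr (- s)"
    by (simp_all add: u_def v_def power2_eq_square flip: powr_add)
  ultimately show ?thesis
    using sum_squares_bound[of u v] by simp
qed

text \<open>Up to the factor \<open>s\<close>, this is the midpoint rule for the convex function t
  powr (- 1 - s) on [x - h, x + h]. Instead of using integrals, the difference \<open>F\<close> of
  the two sides is viewed as a function of the half-width: it vanishes at 0, and its derivative is
  nonnegative by midpoint convexity with exponent \<open>1 + s\<close>.\<close>

lemma midpoint_powr_le:
  fixes h s x :: real
  assumes "s > 0" "0 \<le> h" "h < x"
  shows "2 * h * s * x powr (- 1 - s) \<le> (x - h) powr (- s) - (x + h) powr (- s)"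
proof -
  define F where "F t = (x - t) powr (- s) - (x + t) powr (- s) - 2 * t * s * x powr (- 1 - s)" for t
  have "F 0 \<le> F h"
  proof (rule DERIV_nonneg_imp_nondecreasing[OF assms(2)])
    fix t assume t: "0 \<le> t" "t \<le> h"
    have "(F has_real_derivative
        s * ((x - t) powr (- (1 + s)) + (x + t) powr (- (1 + s)) - 2 * x powr (- (1 + s)))) (at t)"
      unfolding F_def
      using t assms by (auto intro!: derivative_eq_intros simp: distrib_left right_diff_distrib minus_diff_commute)
    moreover have "s * ((x - t) powr (- (1 + s)) + (x + t) powr (- (1 + s)) - 2 * x powr (- (1 + s))) \<ge> 0"
      using powr_neg_add_ge[of "1 + s" t x] t assms by (intro mult_nonneg_nonneg) auto
    ultimately show "\<exists>y. DERIV F t :> y \<and> y \<ge> 0"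
      by blast
  qed
  then show ?thesis
    by (simp add: F_def)
qed

text \<open>With h = 1/2 the midpoint intervals [n - 1/2, n + 1/2] fit together without gaps, so the
  bounds telescope. The left end of the first one is the source of the shift by 1/2 in the weights.
  The bound does not depend on \<open>N\<close>.\<close>

lemma sum_powr_tail_le:
  fixes s :: real
  assumes "s > 0" "i \<ge> 1"
  shows "(\<Sum>n=i..N. real n powr (- 1 - s)) \<le> (real i - 1 / 2) powr (- s) / s"
proof (cases "i \<le> N")
  case True
  have "(\<Sum>n=i..N. s * real n powr (- 1 - s))
      \<le> (\<Sum>n=i..N. - ((real (Suc n) - 1 / 2) powr (- s)) - - ((real n - 1 / 2) powr (- s)))"
  proof (rule sum_mono)
    fix n assume "n \<in> {i..N}"
    then show "s * real n powr (- 1 - s)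
        \<le> - ((real (Suc n) - 1 / 2) powr (- s)) - - ((real n - 1 / 2) powr (- s))"
      using midpoint_powr_le[of s "1 / 2" "real n"] assms by (simp add: algebra_simps)
  qed
  also have "\<dots> = (real i - 1 / 2) powr (- s) - (real (Suc N) - 1 / 2) powr (- s)"
    using True by (subst sum_Suc_diff) auto
  also have "\<dots> \<le> (real i - 1 / 2) powr (- s)"
    by simp
  finally show ?thesis
    using assms by (simp add: field_simps flip: sum_distrib_left)
qed (use assms in auto)

text \<open>For s < 1 the integrand is unbounded near 0. The integrals that start at 0 are therefore
  taken from \<open>has_integral_powr_from_0\<close>, and the one over [n, n + 1] arises as their
  difference.\<close>

lemma sum_integral_powr:
  fixes s :: real
  assumes "s > 0"
  shows "(\<Sum>i=1..n. integral {real i - 1..real i} (\<lambda>x. x powr (s - 1))) = real n powr s / s"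
proof (induction n)
  case (Suc n)
  have "((\<lambda>x. x powr (s - 1)) has_integral (real (Suc n) powr (s - 1 + 1) / (s - 1 + 1))) {0..real (Suc n)}"
    "((\<lambda>x. x powr (s - 1)) has_integral (real n powr (s - 1 + 1) / (s - 1 + 1))) {0..real n}"
    using assms by (intro has_integral_powr_from_0; simp)+
  moreover from this(1) have "integral {0..real n} (\<lambda>x. x powr (s - 1))
      + integral {real n..real (Suc n)} (\<lambda>x. x powr (s - 1))
      = integral {0..real (Suc n)} (\<lambda>x. x powr (s - 1))"
    by (intro Henstock_Kurzweil_Integration.integral_combine) (auto simp: has_integral_integrable)
  ultimately show ?case
    using Suc.IH by (simp add: integral_unique)
qed (use assms in simp)

text \<open>Hoelder's inequality is applied with the integral alone in the second factor: its q-th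
  powers add up to n powr s / s, and the p-th powers of the first factor form the sum on the right.
  The powers of n then combine, because s (p - 1) - (p s + 1) = - 1 - s.\<close>

lemma weighted_mean_powr_le:
  fixes c :: "nat \<Rightarrow> real" and p q s :: real
  assumes p: "p > 1" and q: "q > 1" and pq: "1 / p + 1 / q = 1" and s: "s > 0" and n: "n \<ge> 1"
    and c: "\<And>i. c i \<ge> 0"
  shows "((\<Sum>i=1..n. (real i - 1 / 2) powr (s / p) *
        integral {real i - 1..real i} (\<lambda>x. x powr (s - 1)) powr (1 / q) * c i) / real n powr (s + 1 / p)) powr p
    \<le> real n powr (- 1 - s) * (\<Sum>i=1..n. (real i - 1 / 2) powr s * c i powr p) / s powr (p - 1)"
proof -
  define J where "J i = integral {real i - 1..real i} (\<lambda>x. x powr (s - 1))" for i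
  define S where "S = (\<Sum>i=1..n. (real i - 1 / 2) powr s * c i powr p)"
  \<comment> \<open>By convention \<open>integral\<close> is 0 for a non-integrable function, so the
    sign is settled in either case.\<close>
  have J: "J i \<ge> 0" for i
    unfolding J_def by (cases "(\<lambda>x. x powr (s - 1)) integrable_on {real i - 1..real i}")
      (auto intro: integral_nonneg simp: not_integrable_integral)
  have S: "S \<ge> 0"
    unfolding S_def by (intro sum_nonneg) simp
  \<comment> \<open>Raising the Hoelder bound to the power \<open>p\<close> turns its exponent 1 / q
    into p - 1.\<close>
  have pq': "1 / q * p = p - 1"
    using p q pq by (simp add: field_simps)
  have exps: "p * s / q = s * (p - 1)" "p * (s + 1 / p) = p * s + 1"
    using p by (auto simp: distrib_left simp flip: pq')
  have "(\<Sum>i=1..n. (real i - 1 / 2) powr (s / p) * J i powr (1 / q) * c i)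
      = (\<Sum>i=1..n. ((real i - 1 / 2) powr (s / p) * c i) * J i powr (1 / q))"
    by (simp add: mult_ac)
  also have "\<dots> \<le> (\<Sum>i=1..n. ((real i - 1 / 2) powr (s / p) * c i) powr p) powr (1 / p) *
      (\<Sum>i=1..n. (J i powr (1 / q)) powr q) powr (1 / q)"
    using assms by (intro Holder_inequality_sum) auto
  also have "(\<Sum>i=1..n. ((real i - 1 / 2) powr (s / p) * c i) powr p) = S"
    unfolding S_def using p c by (intro sum.cong) (auto simp: powr_mult powr_powr)
  also have "(\<Sum>i=1..n. (J i powr (1 / q)) powr q) = real n powr s / s"
    using q J sum_integral_powr[OF s, of n] by (simp add: powr_powr J_def)
  finally have "(\<Sum>i=1..n. (real i - 1 / 2) powr (s / p) * J i powr (1 / q) * c i) / real n powr (s + 1 / p)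
      \<le> S powr (1 / p) * (real n powr s / s) powr (1 / q) / real n powr (s + 1 / p)"
    by (rule divide_right_mono) simp
  then have "((\<Sum>i=1..n. (real i - 1 / 2) powr (s / p) * J i powr (1 / q) * c i) / real n powr (s + 1 / p)) powr p
      \<le> (S powr (1 / p) * (real n powr s / s) powr (1 / q) / real n powr (s + 1 / p)) powr p"
    using p c by (intro powr_mono2) (auto intro!: divide_nonneg_nonneg sum_nonneg)
  also have "\<dots> = S * (real n powr s / s) powr (p - 1) / real n powr (p * s + 1)"
    using p s S n unfolding powr_divide powr_mult powr_powr pq'
    by (simp add: exps mult.commute)
  also have "\<dots> = S * (real n powr (s * (p - 1)) / real n powr (p * s + 1)) / s powr (p - 1)"
    using s by (simp add: powr_divide powr_powr)
  also have "real n powr (s * (p - 1)) / real n powr (p * s + 1) = real n powr (- 1 - s)"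
    by (simp add: algebra_simps flip: powr_diff)
  finally show ?thesis
    by (simp add: J_def S_def mult_ac)
qed

text \<open>The exponent \<open>s\<close> of the denominator is assembled from two sources: p - 1
  from Hoelder's inequality and 1 from the tail sums. Truncating at \<open>N\<close> keeps the
  exchange of summations finite.\<close>

lemma sum_weighted_mean_powr_le:
  fixes c :: "nat \<Rightarrow> real" and p q s :: real
  assumes p: "p > 1" and q: "q > 1" and pq: "1 / p + 1 / q = 1" and s: "s > 0"
    and c: "\<And>i. c i \<ge> 0"
  shows "(\<Sum>n=1..N. ((\<Sum>i=1..n. (real i - 1 / 2) powr (s / p) *
        integral {real i - 1..real i} (\<lambda>x. x powr (s - 1)) powr (1 / q) * c i) / real n powr (s + 1 / p)) powr p)
    \<le> (\<Sum>i=1..N. c i powr p) / s powr p"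
    (is "(\<Sum>n=1..N. ?b n) \<le> _")
proof -
  define w where "w i = (real i - 1 / 2) powr s * c i powr p" for i
  have "(\<Sum>n=1..N. ?b n) \<le> (\<Sum>n=1..N. real n powr (- 1 - s) * (\<Sum>i=1..n. w i) / s powr (p - 1))"
    unfolding w_def using assms by (intro sum_mono weighted_mean_powr_le) auto
  also have "\<dots> = (\<Sum>n=1..N. \<Sum>i=1..n. w i * real n powr (- 1 - s)) / s powr (p - 1)"
    by (simp add: sum_divide_distrib mult.commute flip: sum_distrib_right)
  also have "(\<Sum>n=1..N. \<Sum>i=1..n. w i * real n powr (- 1 - s))
      = (\<Sum>i=1..N. \<Sum>n=i..N. w i * real n powr (- 1 - s))"
    \<comment> \<open>Both double sums run over the triangle 1 <= i <= n <= N, with the coordinates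
      of the pairs swapped.\<close>
    unfolding sum.Sigma[OF finite_atLeastAtMost ballI[OF finite_atLeastAtMost]]
    by (rule sum.reindex_bij_witness[of _ prod.swap prod.swap]) auto
  also have "\<dots> \<le> (\<Sum>i=1..N. c i powr p / s)"
  proof (rule sum_mono)
    fix i assume i: "i \<in> {1..N}"
    have "(\<Sum>n=i..N. w i * real n powr (- 1 - s)) \<le> w i * ((real i - 1 / 2) powr (- s) / s)"
      using sum_powr_tail_le[OF s, of i N] i
      by (auto simp: w_def simp del: times_divide_eq_right simp flip: sum_distrib_left intro!: mult_left_mono)
    also have "\<dots> = c i powr p / s"
      \<comment> \<open>As i >= 1, the base i - 1/2 is positive and its powers \<open>s\<close> and
        \<open>- s\<close> cancel.\<close>
      using i by (simp add: w_def powr_minus)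
    finally show "(\<Sum>n=i..N. w i * real n powr (- 1 - s)) \<le> c i powr p / s" .
  qed
  also have "\<dots> = (\<Sum>i=1..N. c i powr p) / s"
    by (simp add: sum_divide_distrib)
  finally show ?thesis
    using s by (simp add: divide_right_mono powr_diff)
qed

theorem theorem4p1:
  fixes p q \<alpha> :: real and a :: "nat \<Rightarrow> complex"
  assumes "p > 1" and "1 / p + 1 / q = 1"
    and "1 \<le> \<alpha>" and "\<alpha> \<le> 1 + 1 / p"
    and "a \<in> lp_space p"
  defines "T \<equiv> (\<lambda>n. complex_of_real (1 / real n powr \<alpha>) *
      (\<Sum>i=1..n. complex_of_real
         (\<alpha> * (real i - 1 / 2) powr ((1 / p) * (\<alpha> - 1 / p)) *
          (integral {real i - 1..real i} (\<lambda>x. x powr (\<alpha> - 1 - 1 / p))) powr (1 / q)) * a i))"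
  shows "(\<lambda>n. norm (T n) powr p) summable_on {1..} \<and>
    (\<Sum>\<^sub>\<infinity>n\<in>{1..}. norm (T n) powr p)
      \<le> (\<alpha> * p / (\<alpha> * p - 1)) powr p * (\<Sum>\<^sub>\<infinity>n\<in>{1..}. norm (a n) powr p)"
proof -
  \<comment> \<open>The exponents of the statement become s / p, s - 1 and \<alpha> = s + 1 / p. The
    factor \<alpha> is kept out of \<open>W\<close>, so that it later joins 1 / s to form the
    constant.\<close>
  define s where "s = \<alpha> - 1 / p"
  define K where "K = (\<alpha> * p / (\<alpha> * p - 1)) powr p * (\<Sum>\<^sub>\<infinity>n\<in>{1..}. norm (a n) powr p)"
  define W where "W i = (real i - 1 / 2) powr (s / p) *
    integral {real i - 1..real i} (\<lambda>x. x powr (s - 1)) powr (1 / q)" for i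
  have "1 / p < 1"
    using assms(1) by simp
  then have "s > 0"
    using assms(3) unfolding s_def by linarith
  have "q > 0" "1 / q < 1"
    using \<open>1 / p < 1\<close> assms(1,2) by (smt (verit) divide_pos_pos zero_less_divide_1_iff)+
  then have "q > 1"
    by simp
  have summ: "(\<lambda>n. norm (a n) powr p) summable_on {1..}"
    using assms(5) by (simp add: lp_space_def)
  have exp_eq: "\<alpha> - 1 - 1 / p = s - 1"
    by (simp add: s_def)
  have T_le: "norm (T n) \<le> \<alpha> * ((\<Sum>i=1..n. W i * norm (a i)) / real n powr \<alpha>)" for n
  proof -
    have "T n = complex_of_real (1 / real n powr \<alpha>) * (\<Sum>i=1..n. complex_of_real (\<alpha> * W i) * a i)"
      unfolding T_def W_def exp_eq by (simp add: s_def mult.assoc)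
    then have "norm (T n) = norm (\<Sum>i=1..n. complex_of_real (\<alpha> * W i) * a i) / real n powr \<alpha>"
      by (simp add: norm_mult norm_divide)
    also have "\<dots> \<le> (\<Sum>i=1..n. norm (complex_of_real (\<alpha> * W i) * a i)) / real n powr \<alpha>"
      by (intro divide_right_mono norm_sum) simp
    also have "(\<Sum>i=1..n. norm (complex_of_real (\<alpha> * W i) * a i)) = (\<Sum>i=1..n. \<alpha> * (W i * norm (a i)))"
      using assms(3) by (intro sum.cong) (auto simp: norm_mult W_def abs_mult)
    finally show ?thesis
      by (simp flip: sum_distrib_left)
  qed
  \<comment> \<open>The terms are nonnegative, so one bound for all finite subsets gives both the
    summability and the estimate of the infinite sum.\<close>
  have bound: "(\<Sum>n\<in>F. norm (T n) powr p) \<le> K" if F: "finite F" "F \<subseteq> {1..}" for F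
  proof -
    obtain N where "F \<subseteq> {..N}"
      using F(1) finite_nat_iff_bounded_le by blast
    then have "(\<Sum>n\<in>F. norm (T n) powr p) \<le> (\<Sum>n=1..N. norm (T n) powr p)"
      using F(2) by (intro sum_mono2) auto
    also have "\<dots> \<le> (\<Sum>n=1..N. (\<alpha> * ((\<Sum>i=1..n. W i * norm (a i)) / real n powr \<alpha>)) powr p)"
      using T_le assms(1) by (intro sum_mono powr_mono2) auto
    also have "\<dots> = \<alpha> powr p * (\<Sum>n=1..N. ((\<Sum>i=1..n. W i * norm (a i)) / real n powr \<alpha>) powr p)"
      using assms(3) unfolding sum_distrib_left
      by (intro sum.cong powr_mult) (auto simp: W_def sum_nonneg)
    also have "\<dots> \<le> \<alpha> powr p * ((\<Sum>i=1..N. norm (a i) powr p) / s powr p)"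
      using sum_weighted_mean_powr_le[OF assms(1) \<open>q > 1\<close> assms(2) \<open>s > 0\<close>, of "\<lambda>i. norm (a i)" N]
      by (intro mult_left_mono) (simp_all add: W_def s_def)
    also have "\<dots> \<le> \<alpha> powr p * ((\<Sum>\<^sub>\<infinity>n\<in>{1..}. norm (a n) powr p) / s powr p)"
      by (intro mult_left_mono divide_right_mono finite_sum_le_infsum[OF summ]) auto
    also have "\<dots> = (\<alpha> / s) powr p * (\<Sum>\<^sub>\<infinity>n\<in>{1..}. norm (a n) powr p)"
      using assms(3) \<open>s > 0\<close> by (simp add: powr_divide)
    also have "\<alpha> / s = \<alpha> * p / (\<alpha> * p - 1)"
      using assms(1) by (simp add: s_def field_simps)
    finally show ?thesis
      by (simp add: K_def)
  qed
  have "(\<lambda>n. norm (T n) powr p) summable_on {1..}"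
    using bound by (intro nonneg_bdd_above_summable_on bdd_aboveI[of _ K]) auto
  then show ?thesis
    using infsum_le_finite_sums[of _ _ K] bound unfolding K_def by blast
qed

end
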